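(* Let $c,d$ be nonzero complex numbers and $n\geq 2$. All representations of $B_n$ through $\varphi_5$ are representations of the Hecke algebra $\mathcal{H}_n(cd)$. That is, for every representation (algebra homomorphism) $\rho:\mathbb{C}P_n\to \mathrm{End}(W)$ on a complex vector space $W$, the linear extension of $\rho\circ\varphi_5$ to the group algebra $\mathbb{C}B_n$ factors through the quotient map $\mathbb{C}B_n\to\mathcal{H}_n(cd)$.
   Context: $B_n$ is the Artin braid group with generators $\sigma_1,\dots,\sigma_{n-1}$ and relations $\sigma_i\sigma_j=\sigma_j\sigma_i$ for $|i-j|>1$, $\sigma_i\sigma_j\sigma_i=\sigma_j\sigma_i\sigma_j$ for $|i-j|=1$. Hecke algebra: $\mathcal{H}_n(q)$ is the quotient of the group algebra $\mathbb{C}B_n$ by the two-sided ideal generated by the elements $(\sigma_i-1)(\sigma_i+q)$, $i=1,\dots,n-1$. Planar rook algebra: $P_n$ is the monoid of bipartite graphs (diagrams) on two rows of $n$ vertices, each row labelled $1,\dots,n$ from left to right, in which every vertex has degree $0$ or $1$ and every edge joins the top row to the bottom row, and which can be drawn inside the rectangle formed by the vertices without edge crossings. The product $d_1d_2$ is obtained by stacking $d_1$ on top of $d_2$, joining edges that meet in the middle row, and deleting any edge of one diagram that meets a vertex of degree $0$ of the other. $\mathbb{C}P_n$ is the $\mathbb{C}$-algebra with basis $P_n$ and this product extended bilinearly. A vertical line at $i$ is an edge joining top vertex $i$ to bottom vertex $i$. The six elements of $P_2$ are: $d_1$ (no edges); $d_2$ (only the vertical line at $1$); $d_3$ (only the edge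 from bottom vertex $1$ to top vertex $2$); $d_4$ (only the edge from top vertex $1$ to bottom vertex $2$); $d_5$ (only the vertical line at $2$); $d_6$ (vertical lines at $1$ and $2$). For $1\le i\le n-1$, $d_{ji}\in P_n$ is the diagram that is $d_j$ on vertices $i,i+1$ and has vertical lines at all other positions. $\varphi_5:B_n\to(\mathbb{C}P_n)^*$ (units of $\mathbb{C}P_n$) is the group homomorphism with \[ \varphi_5(\sigma_i)=(1-c-d+cd)d_{1i}-d_{2i}+c\,d_{3i}+d\,d_{4i}-cd\,d_{5i}+d_{6i}. \] *)

theory Defs
  imports
    "HOL-Analysis.Analysis"
    "HOL-Algebra.QuotRing"
    "HOL-Algebra.Module"
begin

section \<open>Groups given by generators and relations\<close>

text \<open>A letter \<open>(s, True)\<close> stands for the generator \<open>s\<close> and \<open>(s, False)\<close> for its inverse.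
  A relation \<open>l = r\<close> is given as the pair \<open>(l, r)\<close> of words.\<close>

definition group_words :: "'s set \<Rightarrow> ('s \<times> bool) list set" where
  "group_words S = lists (S \<times> UNIV)"

inductive presentation_eq ::
    "'s set \<Rightarrow> (('s \<times> bool) list \<times> ('s \<times> bool) list) set
      \<Rightarrow> ('s \<times> bool) list \<Rightarrow> ('s \<times> bool) list \<Rightarrow> bool"
  for S R where
  refl: "w \<in> group_words S \<Longrightarrow> presentation_eq S R w w"
| sym: "presentation_eq S R v w \<Longrightarrow> presentation_eq S R w v"
| trans: "presentation_eq S R u v \<Longrightarrow> presentation_eq S R v w \<Longrightarrow> presentation_eq S R u w"
| cancel: "s \<in> S \<Longrightarrow> u \<in> group_words S \<Longrightarrow> v \<in> group_words S \<Longrightarrow>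
    presentation_eq S R (u @ [(s, b), (s, \<not> b)] @ v) (u @ v)"
| relation: "(l, r) \<in> R \<Longrightarrow> l \<in> group_words S \<Longrightarrow> r \<in> group_words S \<Longrightarrow>
    u \<in> group_words S \<Longrightarrow> v \<in> group_words S \<Longrightarrow>
    presentation_eq S R (u @ l @ v) (u @ r @ v)"

definition presentation_class ::
    "'s set \<Rightarrow> (('s \<times> bool) list \<times> ('s \<times> bool) list) set
      \<Rightarrow> ('s \<times> bool) list \<Rightarrow> ('s \<times> bool) list set" where
  "presentation_class S R w = {v. presentation_eq S R w v}"

definition presented_group ::
    "'s set \<Rightarrow> (('s \<times> bool) list \<times> ('s \<times> bool) list) set
      \<Rightarrow> ('s \<times> bool) list set monoid" where
  "presented_group S R =
    \<lparr>carrier = presentation_class S R ` group_words S,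
     mult = (\<lambda>X Y. \<Union>x\<in>X. \<Union>y\<in>Y. presentation_class S R (x @ y)),
     one = presentation_class S R []\<rparr>"


section \<open>The Artin braid group\<close>

type_synonym braid = "(nat \<times> bool) list set"

definition braid_generators :: "nat \<Rightarrow> nat set" where
  "braid_generators n = {1..n - 1}"

definition braid_relations :: "nat \<Rightarrow> ((nat \<times> bool) list \<times> (nat \<times> bool) list) set" where
  "braid_relations n =
    {([(i, True), (j, True)], [(j, True), (i, True)]) | i j.
       i \<in> braid_generators n \<and> j \<in> braid_generators n \<and> \<bar>int i - int j\<bar> > 1} \<union>
    {([(i, True), (j, True), (i, True)], [(j, True), (i, True), (j, True)]) | i j.
       i \<in> braid_generators n \<and> j \<in> braid_generators n \<and> \<bar>int i - int j\<bar> = 1}"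

definition braid_group :: "nat \<Rightarrow> braid monoid" where
  "braid_group n = presented_group (braid_generators n) (braid_relations n)"

definition braid_sigma :: "nat \<Rightarrow> nat \<Rightarrow> braid" where
  "braid_sigma n i = presentation_class (braid_generators n) (braid_relations n) [(i, True)]"


section \<open>Complex algebras\<close>

text \<open>A complex algebra is a \<^typ>\<open>(complex, 'a) module\<close> record, i.e. a ring record with a
  scalar multiplication. (The locale \<^locale>\<open>algebra\<close> cannot be used, as it requires the ring
  to be commutative.)\<close>

definition alg_hom :: "(complex, 'a) module \<Rightarrow> (complex, 'b) module \<Rightarrow> ('a \<Rightarrow> 'b) set" where
  "alg_hom A B = {h \<in> ring_hom A B. \<forall>a. \<forall>x\<in>carrier A. h (a \<odot>\<^bsub>A\<^esub> x) = a \<odot>\<^bsub>B\<^esub> h x}"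

definition monoid_algebra :: "('m, 'e) monoid_scheme \<Rightarrow> (complex, 'm \<Rightarrow> complex) module" where
  "monoid_algebra M =
    \<lparr>carrier = {f. finite {x. f x \<noteq> 0} \<and> {x. f x \<noteq> 0} \<subseteq> carrier M},
     mult = (\<lambda>f g x. \<Sum>(y, z) \<in> {(y, z). f y \<noteq> 0 \<and> g z \<noteq> 0 \<and> y \<otimes>\<^bsub>M\<^esub> z = x}. f y * g z),
     one = (\<lambda>x. if x = \<one>\<^bsub>M\<^esub> then 1 else 0),
     zero = (\<lambda>x. 0),
     add = (\<lambda>f g x. f x + g x),
     smult = (\<lambda>a f x. a * f x)\<rparr>"

definition basis_elt :: "'m \<Rightarrow> 'm \<Rightarrow> complex" where
  "basis_elt m = (\<lambda>x. if x = m then 1 else 0)"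

text \<open>The linear extension of \<open>h : M \<rightarrow> A\<close> to the monoid algebra of \<open>M\<close>.\<close>

definition linear_extension :: "(complex, 'a) module \<Rightarrow> ('m \<Rightarrow> 'a) \<Rightarrow> ('m \<Rightarrow> complex) \<Rightarrow> 'a" where
  "linear_extension A h f = (\<Oplus>\<^bsub>A\<^esub>x\<in>{x. f x \<noteq> 0}. f x \<odot>\<^bsub>A\<^esub> h x)"

definition quotient_algebra :: "(complex, 'a) module \<Rightarrow> 'a set \<Rightarrow> (complex, 'a set) module" where
  "quotient_algebra A I = ring.extend (A Quot I)
    (module.fields (\<lambda>a X. \<Union>x\<in>X. I +>\<^bsub>A\<^esub> (a \<odot>\<^bsub>A\<^esub> x)))"

definition quotient_map :: "(complex, 'a) module \<Rightarrow> 'a set \<Rightarrow> 'a \<Rightarrow> 'a set" where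
  "quotient_map A I x = I +>\<^bsub>A\<^esub> x"

definition End_algebra ::
    "(complex \<Rightarrow> 'w \<Rightarrow> 'w::ab_group_add) \<Rightarrow> (complex, 'w \<Rightarrow> 'w) module" where
  "End_algebra smul =
    \<lparr>carrier = {f. Vector_Spaces.linear smul smul f},
     mult = (\<lambda>f g. f \<circ> g),
     one = id,
     zero = (\<lambda>w. 0),
     add = (\<lambda>f g w. f w + g w),
     smult = (\<lambda>a f w. smul a (f w))\<rparr>"


section \<open>The Hecke algebra\<close>

definition braid_group_algebra :: "nat \<Rightarrow> (complex, braid \<Rightarrow> complex) module" where
  "braid_group_algebra n = monoid_algebra (braid_group n)"

definition hecke_ideal :: "nat \<Rightarrow> complex \<Rightarrow> (braid \<Rightarrow> complex) set" where
  "hecke_ideal n q = (let A = braid_group_algebra n in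
    Idl\<^bsub>A\<^esub> {(basis_elt (braid_sigma n i) \<ominus>\<^bsub>A\<^esub> \<one>\<^bsub>A\<^esub>) \<otimes>\<^bsub>A\<^esub>
          (basis_elt (braid_sigma n i) \<oplus>\<^bsub>A\<^esub> q \<odot>\<^bsub>A\<^esub> \<one>\<^bsub>A\<^esub>) | i. i \<in> {1..n - 1}})"

definition hecke_algebra :: "nat \<Rightarrow> complex \<Rightarrow> (complex, (braid \<Rightarrow> complex) set) module" where
  "hecke_algebra n q = quotient_algebra (braid_group_algebra n) (hecke_ideal n q)"

definition hecke_map :: "nat \<Rightarrow> complex \<Rightarrow> (braid \<Rightarrow> complex) \<Rightarrow> (braid \<Rightarrow> complex) set" where
  "hecke_map n q = quotient_map (braid_group_algebra n) (hecke_ideal n q)"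


section \<open>The planar rook algebra\<close>

text \<open>A diagram is its set of edges, where \<open>(i, j)\<close> is the edge joining vertex \<open>i\<close> of the top
  row to vertex \<open>j\<close> of the bottom row. In a drawing, these vertices are placed at the points
  \<open>(i, 1)\<close> and \<open>(j, 0)\<close> of the plane.\<close>

type_synonym diagram = "(nat \<times> nat) set"

definition top_point :: "nat \<Rightarrow> real \<times> real" where
  "top_point i = (real i, 1)"

definition bottom_point :: "nat \<Rightarrow> real \<times> real" where
  "bottom_point j = (real j, 0)"

definition vertex_points :: "nat \<Rightarrow> (real \<times> real) set" where
  "vertex_points n = top_point ` {1..n} \<union> bottom_point ` {1..n}"

definition planar_drawing :: "nat \<Rightarrow> diagram \<Rightarrow> (nat \<times> nat \<Rightarrow> real \<Rightarrow> real \<times> real) \<Rightarrow> bool" where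
  "planar_drawing n d \<gamma> \<longleftrightarrow>
    (\<forall>(i, j)\<in>d.
       arc (\<gamma> (i, j)) \<and>
       pathstart (\<gamma> (i, j)) = top_point i \<and>
       pathfinish (\<gamma> (i, j)) = bottom_point j \<and>
       path_image (\<gamma> (i, j)) \<subseteq> cbox (1, 0) (real n, 1) \<and>
       path_image (\<gamma> (i, j)) \<inter> vertex_points n = {top_point i, bottom_point j}) \<and>
    (\<forall>e\<in>d. \<forall>e'\<in>d. e \<noteq> e' \<longrightarrow> path_image (\<gamma> e) \<inter> path_image (\<gamma> e') = {})"

text \<open>Distinct edges share no vertex by the degree condition, so that they are drawn as
  disjoint arcs.\<close>

definition planar_rook_diagrams :: "nat \<Rightarrow> diagram set" where
  "planar_rook_diagrams n = {d. d \<subseteq> {1..n} \<times> {1..n} \<and>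
    (\<forall>i\<in>{1..n}. card {e \<in> d. fst e = i} \<le> 1) \<and>
    (\<forall>j\<in>{1..n}. card {e \<in> d. snd e = j} \<le> 1) \<and>
    (\<exists>\<gamma>. planar_drawing n d \<gamma>)}"

text \<open>Stacking \<open>d\<^sub>1\<close> on top of \<open>d\<^sub>2\<close> keeps exactly the edges that meet in the middle row, so it is
  the relational composition.\<close>

definition planar_rook_monoid :: "nat \<Rightarrow> diagram monoid" where
  "planar_rook_monoid n =
    \<lparr>carrier = planar_rook_diagrams n, mult = (\<lambda>d\<^sub>1 d\<^sub>2. d\<^sub>1 O d\<^sub>2), one = Id_on {1..n}\<rparr>"

definition planar_rook_algebra :: "nat \<Rightarrow> (complex, diagram \<Rightarrow> complex) module" where
  "planar_rook_algebra n = monoid_algebra (planar_rook_monoid n)"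

text \<open>The six elements \<open>d\<^sub>1, \<dots>, d\<^sub>6\<close> of \<open>P\<^sub>2\<close>.\<close>

definition P2_diagram :: "nat \<Rightarrow> diagram" where
  "P2_diagram j = [{}, {(1, 1)}, {(2, 1)}, {(1, 2)}, {(2, 2)}, {(1, 1), (2, 2)}] ! (j - 1)"

text \<open>\<open>local_diagram n j i\<close> is \<open>d\<^sub>j\<^sub>i\<close>.\<close>

definition local_diagram :: "nat \<Rightarrow> nat \<Rightarrow> nat \<Rightarrow> diagram" where
  "local_diagram n j i =
    (\<lambda>(a, b). (a + i - 1, b + i - 1)) ` P2_diagram j \<union> Id_on ({1..n} - {i, i + 1})"

definition phi5_generator :: "complex \<Rightarrow> complex \<Rightarrow> nat \<Rightarrow> nat \<Rightarrow> diagram \<Rightarrow> complex" where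
  "phi5_generator c d n i =
    (let A = planar_rook_algebra n; D = (\<lambda>j. basis_elt (local_diagram n j i)) in
      (1 - c - d + c * d) \<odot>\<^bsub>A\<^esub> D 1 \<ominus>\<^bsub>A\<^esub> D 2 \<oplus>\<^bsub>A\<^esub> c \<odot>\<^bsub>A\<^esub> D 3 \<oplus>\<^bsub>A\<^esub> d \<odot>\<^bsub>A\<^esub> D 4
        \<ominus>\<^bsub>A\<^esub> (c * d) \<odot>\<^bsub>A\<^esub> D 5 \<oplus>\<^bsub>A\<^esub> D 6)"

end

theory Submission
  imports Defs
begin

text \<open>Write \<open>D\<^sub>a\<^sub>b\<close> for the diagram with vertical lines away from \<open>i, i + 1\<close> and the single further edge
  \<open>(a, b)\<close> with \<open>a, b \<in> {i, i + 1}\<close>, and \<open>D\<close> for the diagram without that edge. Composing such diagrams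
  gives \<open>D\<^sub>a\<^sub>b D\<^sub>b\<^sub>e = D\<^sub>a\<^sub>e\<close>, while every other product of them is \<open>D\<close>. Hence the differences
  \<open>E\<^sub>a\<^sub>b = D\<^sub>a\<^sub>b - D\<close> multiply like \<open>2 \<times> 2\<close> matrix units. In these terms the image of \<open>\<sigma>\<^sub>i\<close> is \<open>1 - M\<close>, where
  \<open>M\<close> is the matrix with rows \<open>(1, -d)\<close> and \<open>(-c, c d)\<close>. It is the product of the column \<open>(1, -c)\<close> and
  the row \<open>(1, -d)\<close>, and its trace is \<open>1 + c d\<close>; so \<open>M\<^sup>2 = (1 + c d) M\<close>, which is the same as
  \<open>(\<sigma>\<^sub>i - 1) (\<sigma>\<^sub>i + c d) = - M (1 + c d - M) = 0\<close>. This is \<open>matrix_units_quadratic\<close> and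
  \<open>phi5_generator_quadratic\<close>. The relation is checked in the endomorphism algebra of \<open>W\<close>, where
  multiplication is composition of maps; the geometry of diagrams enters only in showing that the
  diagrams above are planar (\<open>monotone_planar_rook_diagram\<close>), so that \<open>\<rho>\<close> is multiplicative on them.

  The rest is general algebra. The linear extension of \<open>\<rho> \<circ> \<phi>\<^sub>5\<close> is a homomorphism on the group algebra
  (\<open>linear_extension_alg_hom\<close>), its kernel is an ideal containing the Hecke relations and therefore
  the ideal they generate, and so it descends to the quotient (\<open>alg_hom_factor_quotient\<close>).\<close>

section \<open>Convolution on a monoid\<close>

lemma monoid_algebra_simps [simp]:
  "f \<in> carrier (monoid_algebra M) \<longleftrightarrow> finite {x. f x \<noteq> 0} \<and> {x. f x \<noteq> 0} \<subseteq> carrier M"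
  "\<zero>\<^bsub>monoid_algebra M\<^esub> = (\<lambda>x. 0)"
  "f \<oplus>\<^bsub>monoid_algebra M\<^esub> g = (\<lambda>x. f x + g x)"
  "a \<odot>\<^bsub>monoid_algebra M\<^esub> f = (\<lambda>x. a * f x)"
  "\<one>\<^bsub>monoid_algebra M\<^esub> = basis_elt \<one>\<^bsub>M\<^esub>"
  by (simp_all add: monoid_algebra_def basis_elt_def)

lemma basis_elt_support: "{x. basis_elt m x \<noteq> 0} = {m}"
  by (auto simp: basis_elt_def)

lemma basis_elt_closed: "m \<in> carrier M \<Longrightarrow> basis_elt m \<in> carrier (monoid_algebra M)"
  by (simp add: basis_elt_support)

text \<open>The index sets may exceed the supports, so that products of several functions, such as those in the
  distributive laws, can be summed over common sets.\<close>

lemma monoid_algebra_mult_eq: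
  assumes "finite F" "finite G" "{x. f x \<noteq> 0} \<subseteq> F" "{x. g x \<noteq> 0} \<subseteq> G"
  shows "(f \<otimes>\<^bsub>monoid_algebra M\<^esub> g) x =
    (\<Sum>y\<in>F. \<Sum>z\<in>G. f y * g z * (if y \<otimes>\<^bsub>M\<^esub> z = x then 1 else 0))"
proof -
  have "(f \<otimes>\<^bsub>monoid_algebra M\<^esub> g) x =
      (\<Sum>(y, z) \<in> {(y, z). f y \<noteq> 0 \<and> g z \<noteq> 0 \<and> y \<otimes>\<^bsub>M\<^esub> z = x}. f y * g z)"
    by (simp add: monoid_algebra_def)
  also have "\<dots> = (\<Sum>(y, z) \<in> F \<times> G. f y * g z * (if y \<otimes>\<^bsub>M\<^esub> z = x then 1 else 0))"
    using assms by (intro sum.mono_neutral_cong_left) (auto split: if_splits)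
  finally show ?thesis
    by (simp add: sum.cartesian_product)
qed

lemma monoid_algebra_mult_support:
  "{x. (f \<otimes>\<^bsub>monoid_algebra M\<^esub> g) x \<noteq> 0}
    \<subseteq> (\<lambda>(y, z). y \<otimes>\<^bsub>M\<^esub> z) ` ({y. f y \<noteq> 0} \<times> {z. g z \<noteq> 0})"
proof
  fix x assume "x \<in> {x. (f \<otimes>\<^bsub>monoid_algebra M\<^esub> g) x \<noteq> 0}"
  then have "(\<Sum>(y, z) \<in> {(y, z). f y \<noteq> 0 \<and> g z \<noteq> 0 \<and> y \<otimes>\<^bsub>M\<^esub> z = x}. f y * g z) \<noteq> 0"
    by (simp add: monoid_algebra_def)
  then have "{(y, z). f y \<noteq> 0 \<and> g z \<noteq> 0 \<and> y \<otimes>\<^bsub>M\<^esub> z = x} \<noteq> {}"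
    by (metis (no_types, lifting) sum.empty)
  then show "x \<in> (\<lambda>(y, z). y \<otimes>\<^bsub>M\<^esub> z) ` ({y. f y \<noteq> 0} \<times> {z. g z \<noteq> 0})"
    by force
qed

text \<open>Grouping the pairs \<open>(y, z)\<close> by their product gives the one computation about convolution that is used
  twice: with scalar values of \<open>k\<close> it is the core of associativity, and with \<open>k x\<close> the value
  of a represented monoid element on a vector it makes linear extensions multiplicative.\<close>

lemma sum_monoid_algebra_mult:
  fixes smul :: "complex \<Rightarrow> 'w \<Rightarrow> 'w::ab_group_add"
  assumes "vector_space smul" "finite {x. f x \<noteq> 0}" "finite {x. g x \<noteq> 0}"
  shows "(\<Sum>x | (f \<otimes>\<^bsub>monoid_algebra M\<^esub> g) x \<noteq> 0. smul ((f \<otimes>\<^bsub>monoid_algebra M\<^esub> g) x) (k x)) =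
    (\<Sum>y | f y \<noteq> 0. \<Sum>z | g z \<noteq> 0. smul (f y * g z) (k (y \<otimes>\<^bsub>M\<^esub> z)))"
proof -
  interpret vector_space smul by fact
  let ?P = "{y. f y \<noteq> 0} \<times> {z. g z \<noteq> 0}"
  let ?m = "\<lambda>(y, z). y \<otimes>\<^bsub>M\<^esub> z"
  have fin: "finite ?P" using assms by simp
  have coeff: "(f \<otimes>\<^bsub>monoid_algebra M\<^esub> g) x = (\<Sum>p\<in>{p\<in>?P. ?m p = x}. f (fst p) * g (snd p))" for x
    by (auto simp: monoid_algebra_def case_prod_unfold intro!: sum.cong)
  have "(\<Sum>x | (f \<otimes>\<^bsub>monoid_algebra M\<^esub> g) x \<noteq> 0. smul ((f \<otimes>\<^bsub>monoid_algebra M\<^esub> g) x) (k x)) =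
      (\<Sum>x\<in>?m ` ?P. smul ((f \<otimes>\<^bsub>monoid_algebra M\<^esub> g) x) (k x))"
    using fin monoid_algebra_mult_support[of M f g] by (intro sum.mono_neutral_left) auto
  also have "\<dots> = (\<Sum>x\<in>?m ` ?P. \<Sum>p\<in>{p\<in>?P. ?m p = x}. smul (f (fst p) * g (snd p)) (k (?m p)))"
    by (intro sum.cong refl) (auto simp: coeff scale_sum_left intro!: sum.cong)
  also have "\<dots> = (\<Sum>p\<in>?P. smul (f (fst p) * g (snd p)) (k (?m p)))"
    using fin by (rule sum.image_gen [symmetric])
  also have "\<dots> = (\<Sum>y | f y \<noteq> 0. \<Sum>z | g z \<noteq> 0. smul (f y * g z) (k (y \<otimes>\<^bsub>M\<^esub> z)))"
    by (simp add: sum.cartesian_product case_prod_unfold)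
  finally show ?thesis .
qed

lemma monoid_algebra_mult_closed:
  assumes "monoid M" "f \<in> carrier (monoid_algebra M)" "g \<in> carrier (monoid_algebra M)"
  shows "f \<otimes>\<^bsub>monoid_algebra M\<^esub> g \<in> carrier (monoid_algebra M)"
proof -
  interpret monoid M by fact
  have f: "finite {x. f x \<noteq> 0}" "\<And>x. f x \<noteq> 0 \<Longrightarrow> x \<in> carrier M"
    and g: "finite {x. g x \<noteq> 0}" "\<And>x. g x \<noteq> 0 \<Longrightarrow> x \<in> carrier M"
    using assms(2,3) by (simp_all add: subset_iff)
  let ?P = "(\<lambda>(y, z). y \<otimes>\<^bsub>M\<^esub> z) ` ({y. f y \<noteq> 0} \<times> {z. g z \<noteq> 0})"
  have "finite ?P"
    using f(1) g(1) by (intro finite_imageI finite_cartesian_product)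
  moreover have "?P \<subseteq> carrier M"
    using f(2) g(2) by fastforce
  ultimately show ?thesis
    unfolding monoid_algebra_simps
    using monoid_algebra_mult_support[of M f g] by (blast intro: finite_subset)
qed

lemma monoid_algebra_mult_assoc:
  fixes M :: "('m, 'e) monoid_scheme"
  assumes "monoid M" "f \<in> carrier (monoid_algebra M)" "g \<in> carrier (monoid_algebra M)"
    "h \<in> carrier (monoid_algebra M)"
  shows "(f \<otimes>\<^bsub>monoid_algebra M\<^esub> g) \<otimes>\<^bsub>monoid_algebra M\<^esub> h =
    f \<otimes>\<^bsub>monoid_algebra M\<^esub> (g \<otimes>\<^bsub>monoid_algebra M\<^esub> h)"
proof
  fix x :: 'm
  interpret monoid M by fact
  have vs: "vector_space ((*) :: complex \<Rightarrow> complex \<Rightarrow> complex)"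
    by unfold_locales (auto simp: algebra_simps)
  let ?e = "\<lambda>u. if u = x then 1 else (0::complex)"
  have fin: "finite {x. f x \<noteq> 0}" "finite {x. g x \<noteq> 0}" "finite {x. h x \<noteq> 0}"
    "finite {x. (f \<otimes>\<^bsub>monoid_algebra M\<^esub> g) x \<noteq> 0}" "finite {x. (g \<otimes>\<^bsub>monoid_algebra M\<^esub> h) x \<noteq> 0}"
    using assms monoid_algebra_mult_closed[of M f g] monoid_algebra_mult_closed[of M g h] by auto
  have "((f \<otimes>\<^bsub>monoid_algebra M\<^esub> g) \<otimes>\<^bsub>monoid_algebra M\<^esub> h) x =
      (\<Sum>u | (f \<otimes>\<^bsub>monoid_algebra M\<^esub> g) u \<noteq> 0. (f \<otimes>\<^bsub>monoid_algebra M\<^esub> g) u *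
        (\<Sum>w | h w \<noteq> 0. h w * ?e (u \<otimes>\<^bsub>M\<^esub> w)))"
    by (subst monoid_algebra_mult_eq[OF fin(4,3) order_refl order_refl])
      (simp add: sum_distrib_left mult.assoc)
  also have "\<dots> = (\<Sum>y | f y \<noteq> 0. \<Sum>z | g z \<noteq> 0. f y * g z *
      (\<Sum>w | h w \<noteq> 0. h w * ?e ((y \<otimes>\<^bsub>M\<^esub> z) \<otimes>\<^bsub>M\<^esub> w)))"
    by (rule sum_monoid_algebra_mult[OF vs fin(1,2)])
  also have "\<dots> = (\<Sum>y | f y \<noteq> 0. f y * (\<Sum>z | g z \<noteq> 0. \<Sum>w | h w \<noteq> 0.
      g z * h w * ?e (y \<otimes>\<^bsub>M\<^esub> (z \<otimes>\<^bsub>M\<^esub> w))))"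
  proof -
    have "(y \<otimes>\<^bsub>M\<^esub> z) \<otimes>\<^bsub>M\<^esub> w = y \<otimes>\<^bsub>M\<^esub> (z \<otimes>\<^bsub>M\<^esub> w)" if "f y \<noteq> 0" "g z \<noteq> 0" "h w \<noteq> 0" for y z w
      using that assms by (intro m_assoc) auto
    then show ?thesis by (auto simp: sum_distrib_left mult.assoc intro!: sum.cong)
  qed
  also have "\<dots> = (\<Sum>y | f y \<noteq> 0. f y * (\<Sum>v | (g \<otimes>\<^bsub>monoid_algebra M\<^esub> h) v \<noteq> 0.
      (g \<otimes>\<^bsub>monoid_algebra M\<^esub> h) v * ?e (y \<otimes>\<^bsub>M\<^esub> v)))"
    by (subst sum_monoid_algebra_mult[OF vs fin(2,3)]) simp
  also have "\<dots> = (f \<otimes>\<^bsub>monoid_algebra M\<^esub> (g \<otimes>\<^bsub>monoid_algebra M\<^esub> h)) x"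
    by (subst monoid_algebra_mult_eq[OF fin(1,5) order_refl order_refl])
      (simp add: sum_distrib_left mult.assoc)
  finally show "((f \<otimes>\<^bsub>monoid_algebra M\<^esub> g) \<otimes>\<^bsub>monoid_algebra M\<^esub> h) x =
    (f \<otimes>\<^bsub>monoid_algebra M\<^esub> (g \<otimes>\<^bsub>monoid_algebra M\<^esub> h)) x" .
qed

lemma basis_elt_mult:
  "basis_elt x \<otimes>\<^bsub>monoid_algebra M\<^esub> basis_elt y = basis_elt (x \<otimes>\<^bsub>M\<^esub> y)"
  by (rule ext, subst monoid_algebra_mult_eq[of "{x}" "{y}"])
    (auto simp: basis_elt_def)

lemma abelian_group_monoid_algebra: "abelian_group (monoid_algebra M)"
proof (rule abelian_groupI)
  fix f g assume "f \<in> carrier (monoid_algebra M)" "g \<in> carrier (monoid_algebra M)"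
  moreover have "{x. f x + g x \<noteq> 0} \<subseteq> {x. f x \<noteq> 0} \<union> {x. g x \<noteq> 0}" by auto
  ultimately show "f \<oplus>\<^bsub>monoid_algebra M\<^esub> g \<in> carrier (monoid_algebra M)"
    by (auto intro: finite_subset)
next
  fix f assume "f \<in> carrier (monoid_algebra M)"
  then show "\<exists>g\<in>carrier (monoid_algebra M). g \<oplus>\<^bsub>monoid_algebra M\<^esub> f = \<zero>\<^bsub>monoid_algebra M\<^esub>"
    by (intro bexI[of _ "\<lambda>x. - f x"]) auto
qed (auto simp: algebra_simps)

lemma monoid_algebra_smult_closed:
  assumes "f \<in> carrier (monoid_algebra M)"
  shows "a \<odot>\<^bsub>monoid_algebra M\<^esub> f \<in> carrier (monoid_algebra M)"
  using assms by (cases "a = 0") auto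

lemma monoid_algebra_minus:
  assumes "g \<in> carrier (monoid_algebra M)"
  shows "f \<ominus>\<^bsub>monoid_algebra M\<^esub> g = f \<oplus>\<^bsub>monoid_algebra M\<^esub> (- 1) \<odot>\<^bsub>monoid_algebra M\<^esub> g"
proof -
  interpret abelian_group "monoid_algebra M" by (rule abelian_group_monoid_algebra)
  have "\<ominus>\<^bsub>monoid_algebra M\<^esub> g = (- 1) \<odot>\<^bsub>monoid_algebra M\<^esub> g"
    by (rule minus_equality) (use assms in auto)
  then show ?thesis by (simp add: a_minus_def)
qed

lemma ring_monoid_algebra:
  assumes "monoid M"
  shows "ring (monoid_algebra M)"
proof -
  let ?A = "monoid_algebra M"
  interpret monoid M by fact
  interpret A: abelian_group ?A by (rule abelian_group_monoid_algebra)
  show ?thesis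
  proof (rule ringI)
    show "abelian_group ?A" ..
    show "monoid ?A"
    proof (rule monoidI)
      show "\<one>\<^bsub>?A\<^esub> \<in> carrier ?A"
        by (simp add: basis_elt_support)
      fix f assume f: "f \<in> carrier ?A"
      then have mem: "y \<in> carrier M" if "f y \<noteq> 0" for y
        using that by auto
      have fin: "finite {x. f x \<noteq> 0}" using f by simp
      have one: "{x. basis_elt \<one>\<^bsub>M\<^esub> x \<noteq> 0} \<subseteq> {\<one>\<^bsub>M\<^esub>}" by (simp add: basis_elt_support)
      show "\<one>\<^bsub>?A\<^esub> \<otimes>\<^bsub>?A\<^esub> f = f"
      proof
        fix x
        have "(basis_elt \<one>\<^bsub>M\<^esub> \<otimes>\<^bsub>?A\<^esub> f) x = (\<Sum>z | f z \<noteq> 0. if z = x then f z else 0)"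
          by (subst monoid_algebra_mult_eq[OF _ fin one order_refl])
            (auto simp: basis_elt_def mem intro!: sum.cong)
        then show "(\<one>\<^bsub>?A\<^esub> \<otimes>\<^bsub>?A\<^esub> f) x = f x"
          using fin by simp
      qed
      show "f \<otimes>\<^bsub>?A\<^esub> \<one>\<^bsub>?A\<^esub> = f"
      proof
        fix x
        have "(f \<otimes>\<^bsub>?A\<^esub> basis_elt \<one>\<^bsub>M\<^esub>) x = (\<Sum>z | f z \<noteq> 0. if z = x then f z else 0)"
          by (subst monoid_algebra_mult_eq[OF fin _ order_refl one])
            (auto simp: basis_elt_def mem intro!: sum.cong)
        then show "(f \<otimes>\<^bsub>?A\<^esub> \<one>\<^bsub>?A\<^esub>) x = f x"
          using fin by simp
      qed
    qed (use assms in \<open>auto intro: monoid_algebra_mult_closed monoid_algebra_mult_assoc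
        simp del: monoid_algebra_simps\<close>)
  next
    fix f g h
    assume "f \<in> carrier ?A" "g \<in> carrier ?A"
      and "h \<in> carrier ?A"
    then have fin: "finite ({x. f x \<noteq> 0} \<union> {x. g x \<noteq> 0})" (is "finite ?F")
        "finite {x. h x \<noteq> 0}" (is "finite ?H")
      by auto
    show "((f \<oplus>\<^bsub>?A\<^esub> g) \<otimes>\<^bsub>?A\<^esub> h) = (f \<otimes>\<^bsub>?A\<^esub> h) \<oplus>\<^bsub>?A\<^esub> (g \<otimes>\<^bsub>?A\<^esub> h)"
    proof
      fix x
      let ?e = "\<lambda>y z. if y \<otimes>\<^bsub>M\<^esub> z = x then 1 else (0::complex)"
      have "((f \<oplus>\<^bsub>?A\<^esub> g) \<otimes>\<^bsub>?A\<^esub> h) x =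
          (\<Sum>y\<in>?F. \<Sum>z\<in>?H. (f \<oplus>\<^bsub>?A\<^esub> g) y * h z * ?e y z)"
        and "(f \<otimes>\<^bsub>?A\<^esub> h) x = (\<Sum>y\<in>?F. \<Sum>z\<in>?H. f y * h z * ?e y z)"
        and "(g \<otimes>\<^bsub>?A\<^esub> h) x = (\<Sum>y\<in>?F. \<Sum>z\<in>?H. g y * h z * ?e y z)"
        by (rule monoid_algebra_mult_eq[OF fin]; auto)+
      then show "((f \<oplus>\<^bsub>?A\<^esub> g) \<otimes>\<^bsub>?A\<^esub> h) x =
          ((f \<otimes>\<^bsub>?A\<^esub> h) \<oplus>\<^bsub>?A\<^esub> (g \<otimes>\<^bsub>?A\<^esub> h)) x"
        by (simp add: algebra_simps sum.distrib)
    qed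
    show "(h \<otimes>\<^bsub>?A\<^esub> (f \<oplus>\<^bsub>?A\<^esub> g)) = (h \<otimes>\<^bsub>?A\<^esub> f) \<oplus>\<^bsub>?A\<^esub> (h \<otimes>\<^bsub>?A\<^esub> g)"
    proof
      fix x
      let ?e = "\<lambda>y z. if y \<otimes>\<^bsub>M\<^esub> z = x then 1 else (0::complex)"
      have "(h \<otimes>\<^bsub>?A\<^esub> (f \<oplus>\<^bsub>?A\<^esub> g)) x =
          (\<Sum>y\<in>?H. \<Sum>z\<in>?F. h y * (f \<oplus>\<^bsub>?A\<^esub> g) z * ?e y z)"
        and "(h \<otimes>\<^bsub>?A\<^esub> f) x = (\<Sum>y\<in>?H. \<Sum>z\<in>?F. h y * f z * ?e y z)"
        and "(h \<otimes>\<^bsub>?A\<^esub> g) x = (\<Sum>y\<in>?H. \<Sum>z\<in>?F. h y * g z * ?e y z)"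
        by (rule monoid_algebra_mult_eq[OF fin(2,1)]; auto)+
      then show "(h \<otimes>\<^bsub>?A\<^esub> (f \<oplus>\<^bsub>?A\<^esub> g)) x =
          ((h \<otimes>\<^bsub>?A\<^esub> f) \<oplus>\<^bsub>?A\<^esub> (h \<otimes>\<^bsub>?A\<^esub> g)) x"
        by (simp add: algebra_simps sum.distrib)
    qed
  qed
qed

section \<open>Presented groups\<close>

lemma group_words_append [simp]:
  "u @ v \<in> group_words S \<longleftrightarrow> u \<in> group_words S \<and> v \<in> group_words S"
  by (auto simp: group_words_def)

lemma presentation_eq_words:
  "presentation_eq S R u v \<Longrightarrow> u \<in> group_words S \<and> v \<in> group_words S"
  by (induction rule: presentation_eq.induct) (auto simp: group_words_def)

lemma presentation_eq_context:
  assumes "presentation_eq S R u v" "p \<in> group_words S" "q \<in> group_words S"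
  shows "presentation_eq S R (p @ u @ q) (p @ v @ q)"
  using assms
proof (induction rule: presentation_eq.induct)
  case (cancel s u v b)
  then show ?case using presentation_eq.cancel[of s S "p @ u" "v @ q" R b] by simp
next
  case (relation l r u v)
  then show ?case using presentation_eq.relation[of l r R S "p @ u" "v @ q"] by simp
next
  case (refl w)
  then show ?case by (intro presentation_eq.refl) simp
next
  case (sym u v)
  from sym.IH[OF sym.prems] show ?case by (rule presentation_eq.sym)
next
  case (trans u v w)
  from trans.IH(1)[OF trans.prems] trans.IH(2)[OF trans.prems] show ?case
    by (rule presentation_eq.trans)
qed

lemma presentation_class_eqI:
  "presentation_eq S R u v \<Longrightarrow> presentation_class S R u = presentation_class S R v"
  unfolding presentation_class_def
  using presentation_eq.sym[of S R u v] presentation_eq.trans[of S R u v]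
    presentation_eq.trans[of S R v u] by auto

text \<open>The product of classes is a union over representatives; by compatibility with contexts, all members
  of this union coincide.\<close>

lemma presentation_class_mult:
  assumes "u \<in> group_words S" "v \<in> group_words S"
  shows "presentation_class S R u \<otimes>\<^bsub>presented_group S R\<^esub> presentation_class S R v =
    presentation_class S R (u @ v)"
proof -
  have "presentation_class S R (x @ y) = presentation_class S R (u @ v)"
    if "presentation_eq S R u x" "presentation_eq S R v y" for x y
  proof (rule presentation_class_eqI[OF presentation_eq.sym])
    have "presentation_eq S R (u @ v) (x @ v)"
      using presentation_eq_context[OF that(1), of "[]" v] assms by (simp add: group_words_def)
    moreover have "presentation_eq S R (x @ v) (x @ y)"
      using presentation_eq_context[OF that(2), of x "[]"] presentation_eq_words[OF that(1)]
      by (simp add: group_words_def)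
    ultimately show "presentation_eq S R (u @ v) (x @ y)" by (rule presentation_eq.trans)
  qed
  then have "(\<Union>x\<in>presentation_class S R u. \<Union>y\<in>presentation_class S R v.
      presentation_class S R (x @ y)) =
      (\<Union>x\<in>presentation_class S R u. \<Union>y\<in>presentation_class S R v.
      presentation_class S R (u @ v))"
    by (intro SUP_cong HOL.refl) (simp add: presentation_class_def)
  moreover have "u \<in> presentation_class S R u" "v \<in> presentation_class S R v"
    using assms by (auto simp: presentation_class_def intro: presentation_eq.refl)
  ultimately show ?thesis
    by (auto simp: presented_group_def)
qed

lemma monoid_presented_group: "monoid (presented_group S R)"
proof -
  have car: "carrier (presented_group S R) = presentation_class S R ` group_words S"
    and one: "\<one>\<^bsub>presented_group S R\<^esub> = presentation_class S R []"
    by (simp_all add: presented_group_def)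
  have nil: "[] \<in> group_words S" by (simp add: group_words_def)
  show ?thesis
    by (rule monoidI) (auto simp: car one presentation_class_mult nil)
qed

section \<open>Endomorphism algebras\<close>

lemma End_algebra_simps [simp]:
  "f \<in> carrier (End_algebra smul) \<longleftrightarrow> Vector_Spaces.linear smul smul f"
  "f \<otimes>\<^bsub>End_algebra smul\<^esub> g = f \<circ> g"
  "\<one>\<^bsub>End_algebra smul\<^esub> = id"
  "\<zero>\<^bsub>End_algebra smul\<^esub> = (\<lambda>w. 0)"
  "f \<oplus>\<^bsub>End_algebra smul\<^esub> g = (\<lambda>w. f w + g w)"
  "a \<odot>\<^bsub>End_algebra smul\<^esub> f = (\<lambda>w. smul a (f w))"
  by (simp_all add: End_algebra_def)

lemma ring_End_algebra:
  assumes "vector_space smul"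
  shows "ring (End_algebra smul)"
proof -
  interpret vector_space_pair smul smul using assms by (simp add: vector_space_pair_def)
  show ?thesis
  proof (rule ringI)
    show "abelian_group (End_algebra smul)"
    proof (rule abelian_groupI)
      fix f assume "f \<in> carrier (End_algebra smul)"
      then show "\<exists>g\<in>carrier (End_algebra smul). g \<oplus>\<^bsub>End_algebra smul\<^esub> f = \<zero>\<^bsub>End_algebra smul\<^esub>"
        by (intro bexI[of _ "\<lambda>w. - f w"]) (auto intro: linear_compose_neg)
    qed (auto simp: algebra_simps intro: linear_compose_add linear_zero)
    show "monoid (End_algebra smul)"
      by (rule monoidI) (auto intro: Vector_Spaces.linear_compose vs1.linear_id)
  qed (auto simp: fun_eq_iff linear_add)
qed

text \<open>This turns the abstract sum in \<^const>\<open>linear_extension\<close> into a pointwise sum of vectors, to which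
  the theory of finite sums in a type class applies.\<close>

lemma finsum_End_algebra:
  assumes "vector_space smul" "finite X" "\<And>x. x \<in> X \<Longrightarrow> f x \<in> carrier (End_algebra smul)"
  shows "(\<Oplus>\<^bsub>End_algebra smul\<^esub>x\<in>X. f x) = (\<lambda>w. \<Sum>x\<in>X. f x w)"
proof -
  interpret ring "End_algebra smul" by (rule ring_End_algebra) fact
  show ?thesis
    using assms(2,3)
  proof (induction X rule: finite_induct)
    case (insert x X)
    then have "(\<Oplus>\<^bsub>End_algebra smul\<^esub>x\<in>insert x X. f x) =
        f x \<oplus>\<^bsub>End_algebra smul\<^esub> (\<Oplus>\<^bsub>End_algebra smul\<^esub>x\<in>X. f x)"
      by (intro finsum_insert) (auto simp del: End_algebra_simps)
    then show ?case using insert by simp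
  qed simp
qed

lemma linear_extension_End:
  assumes "vector_space smul" "h \<in> carrier M \<rightarrow> carrier (End_algebra smul)"
    and "f \<in> carrier (monoid_algebra M)" "finite F" "{x. f x \<noteq> 0} \<subseteq> F"
  shows "linear_extension (End_algebra smul) h f = (\<lambda>w. \<Sum>x\<in>F. smul (f x) (h x w))"
proof -
  interpret vector_space_pair smul smul using assms by (simp add: vector_space_pair_def)
  have "linear_extension (End_algebra smul) h f = (\<lambda>w. \<Sum>x | f x \<noteq> 0. smul (f x) (h x w))"
    unfolding linear_extension_def
    using assms by (subst finsum_End_algebra) (auto intro!: linear_compose_scale_right)
  also have "\<dots> = (\<lambda>w. \<Sum>x\<in>F. smul (f x) (h x w))"
    using assms by (intro ext sum.mono_neutral_left) auto
  finally show ?thesis .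
qed

text \<open>The unit has to be assumed to go to the identity, since \<^const>\<open>hom\<close> speaks of products only.\<close>

lemma linear_extension_alg_hom:
  assumes "vector_space smul" "monoid M" "h \<in> hom M (End_algebra smul)" "h \<one>\<^bsub>M\<^esub> = id"
  shows "linear_extension (End_algebra smul) h \<in> alg_hom (monoid_algebra M) (End_algebra smul)"
    (is "?L \<in> alg_hom ?A ?E")
proof -
  interpret monoid M by fact
  interpret vector_space_pair smul smul using assms by (simp add: vector_space_pair_def)
  interpret A: ring ?A by (rule ring_monoid_algebra) fact
  have h: "h \<in> carrier M \<rightarrow> carrier ?E" using assms(3) by (simp add: hom_def)
  then have lin: "Vector_Spaces.linear smul smul (h x)" if "x \<in> carrier M" for x
    using that by auto
  note L = linear_extension_End[OF assms(1) h]
  have L0: "?L f = (\<lambda>w. \<Sum>x | f x \<noteq> 0. smul (f x) (h x w))" if "f \<in> carrier ?A" for f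
    using that by (intro L) auto
  have "?L \<in> ring_hom ?A ?E"
  proof (rule ring_hom_memI)
    fix f assume f: "f \<in> carrier ?A"
    then show "?L f \<in> carrier ?E"
      by (subst L0) (auto intro!: linear_compose_sum linear_compose_scale_right lin)
    fix g assume g: "g \<in> carrier ?A"
    show "?L (f \<otimes>\<^bsub>?A\<^esub> g) = ?L f \<otimes>\<^bsub>?E\<^esub> ?L g"
    proof
      fix w
      have "?L (f \<otimes>\<^bsub>?A\<^esub> g) w = (\<Sum>x | (f \<otimes>\<^bsub>?A\<^esub> g) x \<noteq> 0. smul ((f \<otimes>\<^bsub>?A\<^esub> g) x) (h x w))"
        by (subst L0) (use f g in \<open>auto intro: A.m_closed simp del: monoid_algebra_simps\<close>)
      also have "\<dots> = (\<Sum>y | f y \<noteq> 0. \<Sum>z | g z \<noteq> 0. smul (f y * g z) (h (y \<otimes>\<^bsub>M\<^esub> z) w))"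
        using f g by (intro sum_monoid_algebra_mult assms(1)) auto
      also have "\<dots> = (\<Sum>y | f y \<noteq> 0. smul (f y) (h y (\<Sum>z | g z \<noteq> 0. smul (g z) (h z w))))"
      proof (rule sum.cong[OF HOL.refl])
        fix y assume "y \<in> {y. f y \<noteq> 0}"
        then have y: "y \<in> carrier M" using f by auto
        have "h (y \<otimes>\<^bsub>M\<^esub> z) w = h y (h z w)" if "g z \<noteq> 0" for z
        proof -
          have "z \<in> carrier M" using g that by auto
          then show ?thesis using hom_mult[OF assms(3) y] by simp
        qed
        then show "(\<Sum>z | g z \<noteq> 0. smul (f y * g z) (h (y \<otimes>\<^bsub>M\<^esub> z) w)) =
            smul (f y) (h y (\<Sum>z | g z \<noteq> 0. smul (g z) (h z w)))"
          by (simp add: linear_sum[OF lin[OF y]] linear_scale[OF lin[OF y]] vs1.scale_sum_right)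
      qed
      also have "\<dots> = (?L f \<otimes>\<^bsub>?E\<^esub> ?L g) w" using f g by (simp add: L0)
      finally show "?L (f \<otimes>\<^bsub>?A\<^esub> g) w = (?L f \<otimes>\<^bsub>?E\<^esub> ?L g) w" .
    qed
    let ?F = "{x. f x \<noteq> 0} \<union> {x. g x \<noteq> 0}"
    have "?L f = (\<lambda>w. \<Sum>x\<in>?F. smul (f x) (h x w))" "?L g = (\<lambda>w. \<Sum>x\<in>?F. smul (g x) (h x w))"
      "?L (f \<oplus>\<^bsub>?A\<^esub> g) = (\<lambda>w. \<Sum>x\<in>?F. smul ((f \<oplus>\<^bsub>?A\<^esub> g) x) (h x w))"
      by (rule L; use f g A.a_closed[OF f g] in auto)+
    then show "?L (f \<oplus>\<^bsub>?A\<^esub> g) = ?L f \<oplus>\<^bsub>?E\<^esub> ?L g"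
      by (simp add: sum.distrib vs1.scale_left_distrib)
  next
    show "?L \<one>\<^bsub>?A\<^esub> = \<one>\<^bsub>?E\<^esub>"
      by (subst L[of _ "{\<one>\<^bsub>M\<^esub>}"]) (auto simp: basis_elt_support, simp add: basis_elt_def assms id_def)
  qed
  moreover have "?L (a \<odot>\<^bsub>?A\<^esub> f) = a \<odot>\<^bsub>?E\<^esub> ?L f" if f: "f \<in> carrier ?A" for a f
    using L[OF monoid_algebra_smult_closed[OF f], of "{x. f x \<noteq> 0}" a] f
    by (auto simp: L0 vs1.scale_sum_right)
  ultimately show ?thesis by (simp add: alg_hom_def)
qed

lemma linear_extension_basis_elt:
  fixes M :: "('m, 'e) monoid_scheme"
  assumes "vector_space smul" "h \<in> carrier M \<rightarrow> carrier (End_algebra smul)" "m \<in> carrier M"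
  shows "linear_extension (End_algebra smul) h (basis_elt m) = h m"
proof -
  interpret vector_space smul by fact
  show ?thesis
    by (subst linear_extension_End[OF assms(1,2), of _ "{m}"])
      (auto simp: basis_elt_support assms(3), simp add: basis_elt_def)
qed

section \<open>Factoring through a quotient\<close>

text \<open>As \<open>L\<close> vanishes on \<open>I\<close>, it is constant on each coset, so the induced map sends a coset \<open>X\<close> to the single
  element of \<open>L ` X\<close>. This formula involves no choice of representatives, and its compatibility with the operations
  is read off from any one of them.\<close>

lemma alg_hom_factor_quotient:
  assumes "ring A" "ring B" "ideal I A"
    and smult: "\<And>a x. x \<in> carrier A \<Longrightarrow> a \<odot>\<^bsub>A\<^esub> x \<in> carrier A"
    and L: "L \<in> alg_hom A B" and van: "\<And>x. x \<in> I \<Longrightarrow> L x = \<zero>\<^bsub>B\<^esub>"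
  shows "\<exists>\<psi>\<in>alg_hom (quotient_algebra A I) B. \<forall>x\<in>carrier A. L x = \<psi> (quotient_map A I x)"
proof -
  interpret A: ring A by fact
  interpret B: ring B by fact
  interpret I: ideal I A by fact
  let ?Q = "quotient_algebra A I"
  have hom: "L \<in> ring_hom A B" and Ls: "\<And>a x. x \<in> carrier A \<Longrightarrow> L (a \<odot>\<^bsub>A\<^esub> x) = a \<odot>\<^bsub>B\<^esub> L x"
    using L by (auto simp: alg_hom_def)
  have Q: "carrier ?Q = a_rcosets\<^bsub>A\<^esub> I" "\<And>X Y. X \<otimes>\<^bsub>?Q\<^esub> Y = rcoset_mult A I X Y"
    "\<And>X Y. X \<oplus>\<^bsub>?Q\<^esub> Y = X <+>\<^bsub>A\<^esub> Y" "\<one>\<^bsub>?Q\<^esub> = I +>\<^bsub>A\<^esub> \<one>\<^bsub>A\<^esub>"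
    "\<And>a X. a \<odot>\<^bsub>?Q\<^esub> X = (\<Union>x\<in>X. I +>\<^bsub>A\<^esub> (a \<odot>\<^bsub>A\<^esub> x))"
    by (simp_all add: quotient_algebra_def FactRing_def ring.defs module.defs)
  have mem: "L z = L x \<and> z \<in> carrier A" if "x \<in> carrier A" "z \<in> I +>\<^bsub>A\<^esub> x" for x z
  proof -
    obtain j where "j \<in> I" "z = j \<oplus>\<^bsub>A\<^esub> x"
      using \<open>z \<in> I +>\<^bsub>A\<^esub> x\<close> by (auto simp: a_r_coset_def')
    then show ?thesis
      using that(1) van[of j] ring_hom_add[OF hom, of j x] ring_hom_closed[OF hom that(1)]
        I.a_subset by (auto simp: subset_iff)
  qed
  have img: "L ` (I +>\<^bsub>A\<^esub> x) = {L x}" if "x \<in> carrier A" for x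
    using mem[OF that] I.a_rcos_self[OF that] by blast
  have eq: "the_elem (L ` (I +>\<^bsub>A\<^esub> x)) = L x" if "x \<in> carrier A" for x
    by (simp add: img that)
  have rep: "\<exists>x\<in>carrier A. X = I +>\<^bsub>A\<^esub> x" if "X \<in> carrier ?Q" for X
    using that by (auto simp: Q A_RCOSETS_def')
  show ?thesis
  proof (intro bexI ballI)
    show "L x = the_elem (L ` (quotient_map A I x))" if "x \<in> carrier A" for x
      by (simp add: quotient_map_def eq that)
    have "(\<lambda>X. the_elem (L ` X)) \<in> ring_hom ?Q B"
    proof (rule ring_hom_memI)
      fix X assume "X \<in> carrier ?Q"
      then obtain x where x: "x \<in> carrier A" "X = I +>\<^bsub>A\<^esub> x" using rep by blast
      show "the_elem (L ` X) \<in> carrier B" using x ring_hom_closed[OF hom] by (simp add: eq)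
      fix Y assume "Y \<in> carrier ?Q"
      then obtain y where y: "y \<in> carrier A" "Y = I +>\<^bsub>A\<^esub> y" using rep by blast
      show "the_elem (L ` (X \<otimes>\<^bsub>?Q\<^esub> Y)) = the_elem (L ` X) \<otimes>\<^bsub>B\<^esub> the_elem (L ` Y)"
        using x y ring_hom_mult[OF hom] by (simp add: Q I.rcoset_mult_add eq)
      show "the_elem (L ` (X \<oplus>\<^bsub>?Q\<^esub> Y)) = the_elem (L ` X) \<oplus>\<^bsub>B\<^esub> the_elem (L ` Y)"
        using x y ring_hom_add[OF hom] by (simp add: Q I.a_rcos_sum eq)
    next
      show "the_elem (L ` \<one>\<^bsub>?Q\<^esub>) = \<one>\<^bsub>B\<^esub>"
        using ring_hom_one[OF hom] by (simp add: Q eq)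
    qed
    moreover have "the_elem (L ` (a \<odot>\<^bsub>?Q\<^esub> X)) = a \<odot>\<^bsub>B\<^esub> the_elem (L ` X)" if "X \<in> carrier ?Q" for a X
    proof -
      obtain x where x: "x \<in> carrier A" "X = I +>\<^bsub>A\<^esub> x" using rep \<open>X \<in> carrier ?Q\<close> by blast
      have "L ` (I +>\<^bsub>A\<^esub> (a \<odot>\<^bsub>A\<^esub> z)) = {a \<odot>\<^bsub>B\<^esub> L x}" if "z \<in> X" for z
        using mem[of x z] x that by (simp add: img smult Ls)
      moreover have "x \<in> X" using x I.a_rcos_self by simp
      ultimately have "L ` (a \<odot>\<^bsub>?Q\<^esub> X) = {a \<odot>\<^bsub>B\<^esub> L x}" by (auto simp: Q image_UN)
      then show ?thesis using x by (simp add: eq)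
    qed
    ultimately show "(\<lambda>X. the_elem (L ` X)) \<in> alg_hom ?Q B" by (simp add: alg_hom_def)
  qed
qed

section \<open>Planar rook diagrams\<close>

lemma path_image_edge:
  "path_image (linepath (top_point a) (bottom_point b)) =
    (\<lambda>t. ((1 - t) * real a + t * real b, 1 - t)) ` {0..1}"
  by (auto simp: path_image_def linepath_def top_point_def bottom_point_def)

text \<open>Straight segments serve as the drawing: if \<open>a < a'\<close> and \<open>b < b'\<close>, then at every height the segment
  from \<open>a\<close> to \<open>b\<close> lies strictly to the left of the one from \<open>a'\<close> to \<open>b'\<close>. The interior of a segment
  has height strictly between 0 and 1 and thus avoids all vertices.\<close>

lemma monotone_planar_rook_diagram:
  assumes sub: "D \<subseteq> {1..n} \<times> {1..n}"
    and mono: "\<And>a b a' b'. (a, b) \<in> D \<Longrightarrow> (a', b') \<in> D \<Longrightarrow> a < a' \<longleftrightarrow> b < b'"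
  shows "D \<in> planar_rook_diagrams n"
proof -
  have fin: "finite D" using sub by (rule finite_subset) simp
  have inj: "a = a' \<longleftrightarrow> b = b'" if "(a, b) \<in> D" "(a', b') \<in> D" for a b a' b'
    using mono[OF that] mono[OF that(2,1)] by (metis linorder_neq_iff)
  have card: "card {e \<in> D. fst e = i} \<le> 1" "card {e \<in> D. snd e = i} \<le> 1" for i
    using fin by (simp_all add: card_le_Suc0_iff_eq) (metis inj)+
  let ?\<gamma> = "\<lambda>(a, b). linepath (top_point a) (bottom_point b)"
  have "arc (?\<gamma> (a, b)) \<and> path_image (?\<gamma> (a, b)) \<subseteq> cbox (1, 0) (real n, 1) \<and>
      path_image (?\<gamma> (a, b)) \<inter> vertex_points n = {top_point a, bottom_point b}"
    if "(a, b) \<in> D" for a b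
  proof (intro conjI)
    have ab: "1 \<le> a" "a \<le> n" "1 \<le> b" "b \<le> n" using that sub by auto
    show "arc (?\<gamma> (a, b))" by (simp add: top_point_def bottom_point_def)
    have "top_point a \<in> cbox (1, 0) (real n, 1)" "bottom_point b \<in> cbox (1, 0) (real n, 1)"
      using ab by (auto simp: cbox_Pair_eq top_point_def bottom_point_def)
    then show "path_image (?\<gamma> (a, b)) \<subseteq> cbox (1, 0) (real n, 1)"
      by (simp add: closed_segment_subset)
    show "path_image (?\<gamma> (a, b)) \<inter> vertex_points n = {top_point a, bottom_point b}"
    proof
      show "{top_point a, bottom_point b} \<subseteq> path_image (?\<gamma> (a, b)) \<inter> vertex_points n"
        using ab by (auto simp: vertex_points_def)
      show "path_image (?\<gamma> (a, b)) \<inter> vertex_points n \<subseteq> {top_point a, bottom_point b}"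
        unfolding case_prod_conv path_image_edge
        by (auto simp: vertex_points_def top_point_def bottom_point_def)
    qed
  qed
  moreover have "path_image (?\<gamma> e) \<inter> path_image (?\<gamma> e') = {}"
    if "e \<in> D" "e' \<in> D" "e \<noteq> e'" for e e'
  proof -
    have disj: "path_image (?\<gamma> (a, b)) \<inter> path_image (?\<gamma> (a', b')) = {}"
      if "a < a'" "b < b'" for a b a' b'
    proof -
      have "(1 - t) * real a + t * real b \<noteq> (1 - t) * real a' + t * real b'"
        if "0 \<le> t" "t \<le> 1" for t
      proof -
        have "(1 - t) * real a + t * real b < (1 - t) * real a' + t * real b'"
        proof (cases "t = 1")
          case False
          then show ?thesis
            using that \<open>a < a'\<close> \<open>b < b'\<close>
            by (intro add_less_le_mono mult_strict_left_mono mult_left_mono) auto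
        qed (use \<open>b < b'\<close> in simp)
        then show ?thesis by simp
      qed
      then show ?thesis unfolding case_prod_conv path_image_edge by auto
    qed
    obtain a b a' b' where e: "e = (a, b)" "e' = (a', b')" by (cases e; cases e')
    with that inj[of a b a' b'] have "a \<noteq> a'" by auto
    with that e mono[of a b a' b'] mono[of a' b' a b] have "a < a' \<and> b < b' \<or> a' < a \<and> b' < b"
      by auto
    then show ?thesis using disj[of a a' b b'] disj[of a' a b' b] e by blast
  qed
  ultimately have "planar_drawing n D ?\<gamma>"
    by (auto simp: planar_drawing_def)
  with sub card show ?thesis by (auto simp: planar_rook_diagrams_def)
qed

definition outer_lines :: "nat \<Rightarrow> nat \<Rightarrow> diagram" where
  "outer_lines n i = Id_on ({1..n} - {i, i + 1})"

lemma local_diagram_eqs: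
  "local_diagram n 1 i = outer_lines n i"
  "local_diagram n 2 i = insert (i, i) (outer_lines n i)"
  "local_diagram n 3 i = insert (i + 1, i) (outer_lines n i)"
  "local_diagram n 4 i = insert (i, i + 1) (outer_lines n i)"
  "local_diagram n 5 i = insert (i + 1, i + 1) (outer_lines n i)"
  "i \<in> {1..n - 1} \<Longrightarrow> local_diagram n 6 i = Id_on {1..n}"
  by (auto simp: local_diagram_def P2_diagram_def outer_lines_def)

lemma outer_lines_closed: "outer_lines n i \<in> planar_rook_diagrams n"
  by (rule monotone_planar_rook_diagram) (auto simp: outer_lines_def)

lemma edge_outer_lines_closed:
  assumes "i \<in> {1..n - 1}" "a \<in> {i, i + 1}" "b \<in> {i, i + 1}"
  shows "insert (a, b) (outer_lines n i) \<in> planar_rook_diagrams n"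
  using assms by (intro monotone_planar_rook_diagram) (auto simp: outer_lines_def)

text \<open>An edge at \<open>i, i + 1\<close> survives a composition exactly if it meets its partner in the middle row, so up
  to subtracting the diagram of outer lines these are the relations of matrix units.\<close>

lemma edge_outer_lines_comp:
  assumes "a \<in> {i, i + 1}" "b \<in> {i, i + 1}" "a' \<in> {i, i + 1}" "b' \<in> {i, i + 1}"
  shows "insert (a, b) (outer_lines n i) O insert (a', b') (outer_lines n i) =
      (if b = a' then insert (a, b') (outer_lines n i) else outer_lines n i)"
    and "insert (a, b) (outer_lines n i) O outer_lines n i = outer_lines n i"
    and "outer_lines n i O insert (a', b') (outer_lines n i) = outer_lines n i"
    and "outer_lines n i O outer_lines n i = outer_lines n i"
  using assms by (auto simp: outer_lines_def Id_on_def)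

section \<open>The quadratic relation\<close>

text \<open>Here \<open>T = 1 - M\<close> for the rank-one matrix \<open>M\<close> that is the product of the column \<open>(1, -c)\<close> and the row
  \<open>(1, -d)\<close>. Its trace \<open>1 + c d\<close> gives \<open>M\<^sup>2 = (1 + c d) M\<close>, and the claim is \<open>(T - 1) (T + c d) = 0\<close>
  applied to the vector \<open>w\<close>.\<close>

lemma matrix_units_quadratic:
  fixes smul :: "complex \<Rightarrow> 'w \<Rightarrow> 'w::ab_group_add"
    and E :: "nat \<Rightarrow> nat \<Rightarrow> 'w \<Rightarrow> 'w"
    and c d :: complex and p q :: nat
  defines "T \<equiv> \<lambda>w. w - (E p p w - smul c (E q p w) - smul d (E p q w) + smul (c * d) (E q q w))"
  assumes "vector_space smul" "p \<noteq> q"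
    and lin: "\<And>a b. a \<in> {p, q} \<Longrightarrow> b \<in> {p, q} \<Longrightarrow> Vector_Spaces.linear smul smul (E a b)"
    and mult: "\<And>a b a' b' w. a \<in> {p, q} \<Longrightarrow> b \<in> {p, q} \<Longrightarrow> a' \<in> {p, q} \<Longrightarrow> b' \<in> {p, q} \<Longrightarrow>
      E a b (E a' b' w) = (if b = a' then E a b' w else 0)"
  shows "T (T w + smul (c * d) w) - (T w + smul (c * d) w) = 0"
proof -
  interpret vector_space_pair smul smul using assms(2) by (simp add: vector_space_pair_def)
  define M where "M w = E p p w - smul c (E q p w) - smul d (E p q w) + smul (c * d) (E q q w)" for w
  have T: "T w = w - M w" for w by (simp add: T_def M_def)
  have linM: "Vector_Spaces.linear smul smul M"
    unfolding M_def
    by (intro linear_compose_add linear_compose_sub linear_compose_scale_right lin) auto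
  note E_lin = linear_add[OF lin] linear_diff[OF lin] linear_scale[OF lin]
  \<comment> \<open>Because \<open>M\<close> has rank one, its second row is \<open>- c\<close> times its first.\<close>
  have row: "E a p (M w) = E a p w - smul d (E a q w)"
      "E a q (M w) = - smul c (E a p w - smul d (E a q w))" if "a \<in> {p, q}" for a w
    using that \<open>p \<noteq> q\<close> by (auto simp: M_def E_lin mult vs1.scale_right_diff_distrib algebra_simps)
  have MM: "M (M w) = smul (1 + c * d) (M w)" for w
    by (subst M_def, simp add: row)
      (simp add: M_def vs1.scale_right_diff_distrib vs1.scale_right_distrib vs1.scale_left_distrib
        algebra_simps)
  show ?thesis
    by (simp add: T linear_add[OF linM] linear_diff[OF linM] linear_scale[OF linM] MM
        vs1.scale_left_distrib)
qed

text \<open>Evaluation at a vector replaces computations with the record operations of the algebras by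
  computations in an additive group with scalar multiplication.\<close>

lemma alg_hom_End_eval:
  assumes h: "h \<in> alg_hom (monoid_algebra M) (End_algebra smul)" and "vector_space smul"
    and f: "f \<in> carrier (monoid_algebra M)"
  shows "g \<in> carrier (monoid_algebra M) \<Longrightarrow> h (f \<oplus>\<^bsub>monoid_algebra M\<^esub> g) w = h f w + h g w"
    and "g \<in> carrier (monoid_algebra M) \<Longrightarrow> h (f \<ominus>\<^bsub>monoid_algebra M\<^esub> g) w = h f w - h g w"
    and "g \<in> carrier (monoid_algebra M) \<Longrightarrow> h (f \<otimes>\<^bsub>monoid_algebra M\<^esub> g) w = h f (h g w)"
    and "h (a \<odot>\<^bsub>monoid_algebra M\<^esub> f) w = smul a (h f w)"
    and "Vector_Spaces.linear smul smul (h f)"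
proof -
  interpret vector_space smul by fact
  have hom: "h \<in> ring_hom (monoid_algebra M) (End_algebra smul)"
    using h by (simp add: alg_hom_def)
  have add: "h (f \<oplus>\<^bsub>monoid_algebra M\<^esub> g) w = h f w + h g w" if "g \<in> carrier (monoid_algebra M)" for g
    using ring_hom_add[OF hom f that] by (simp del: monoid_algebra_simps)
  have scale: "h (a \<odot>\<^bsub>monoid_algebra M\<^esub> f) w = smul a (h f w)" if "f \<in> carrier (monoid_algebra M)" for a f
    using h that by (simp add: alg_hom_def del: monoid_algebra_simps)
  show "h (f \<oplus>\<^bsub>monoid_algebra M\<^esub> g) w = h f w + h g w" if "g \<in> carrier (monoid_algebra M)"
    using add[OF that] .
  show "h (f \<ominus>\<^bsub>monoid_algebra M\<^esub> g) w = h f w - h g w" if g: "g \<in> carrier (monoid_algebra M)"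
    using add[OF monoid_algebra_smult_closed[OF g]] scale[OF g]
    by (simp add: monoid_algebra_minus[OF g] del: monoid_algebra_simps)
  show "h (f \<otimes>\<^bsub>monoid_algebra M\<^esub> g) w = h f (h g w)" if "g \<in> carrier (monoid_algebra M)"
    using ring_hom_mult[OF hom f that] by simp
  show "h (a \<odot>\<^bsub>monoid_algebra M\<^esub> f) w = smul a (h f w)"
    using scale[OF f] .
  show "Vector_Spaces.linear smul smul (h f)"
    using ring_hom_closed[OF hom f] by simp
qed

text \<open>Subtracting the diagram of outer lines from each diagram with one extra edge gives matrix units. After
  the substitution \<open>D\<^sub>a\<^sub>b = E\<^sub>a\<^sub>b + D\<close>, the coefficients of \<open>D\<close> are \<open>1 - c - d + c d\<close>, \<open>- 1\<close>, \<open>c\<close>, \<open>d\<close>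
  and \<open>- c d\<close>. They cancel, which leaves \<open>1 - M\<close>.\<close>

lemma phi5_generator_quadratic:
  fixes c d :: complex
  assumes vs: "vector_space smul"
    and \<rho>: "\<rho> \<in> alg_hom (planar_rook_algebra n) (End_algebra smul)"
    and i: "i \<in> {1..n - 1}"
  defines "S \<equiv> \<rho> (phi5_generator c d n i)"
  shows "S (S w + smul (c * d) w) - (S w + smul (c * d) w) = 0"
proof -
  interpret vector_space_pair smul smul using vs by (simp add: vector_space_pair_def)
  let ?P = "planar_rook_monoid n" and ?A = "planar_rook_algebra n"
  interpret A: abelian_group ?A
    unfolding planar_rook_algebra_def by (rule abelian_group_monoid_algebra)
  have hom: "\<rho> \<in> ring_hom ?A (End_algebra smul)" using \<rho> by (simp add: alg_hom_def)
  note eval = alg_hom_End_eval[OF \<rho>[unfolded planar_rook_algebra_def] vs,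
      folded planar_rook_algebra_def]
  let ?O = "outer_lines n i"
  let ?D = "\<lambda>a b. insert (a, b) (outer_lines n i)"
  define R where "R D = \<rho> (basis_elt D)" for D
  have cl: "basis_elt D \<in> carrier ?A" if "D \<in> planar_rook_diagrams n" for D
    unfolding planar_rook_algebra_def
    by (rule basis_elt_closed) (simp add: planar_rook_monoid_def that)
  have R_mult: "R D (R D' w) = R (D O D') w"
    if "D \<in> planar_rook_diagrams n" "D' \<in> planar_rook_diagrams n" for D D' w
    using eval(3)[OF cl[OF that(1)] cl[OF that(2)], of w]
    by (simp add: R_def planar_rook_algebra_def basis_elt_mult) (simp add: planar_rook_monoid_def)
  have R_lin: "Vector_Spaces.linear smul smul (R D)" if "D \<in> planar_rook_diagrams n" for D
    using eval(5)[OF cl[OF that]] by (simp add: R_def)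
  have one: "basis_elt (Id_on {1..n}) = \<one>\<^bsub>?A\<^esub>"
    by (simp add: planar_rook_algebra_def) (simp add: planar_rook_monoid_def)
  have \<rho>_one: "\<rho> \<one>\<^bsub>?A\<^esub> w = w" for w using ring_hom_one[OF hom] by simp
  have one_closed: "\<one>\<^bsub>?A\<^esub> \<in> carrier ?A"
    unfolding one [symmetric] by (rule cl) (auto intro!: monotone_planar_rook_diagram)
  define E where "E a b w = R (?D a b) w - R ?O w" for a b w
  note closed = outer_lines_closed[of n i] edge_outer_lines_closed[OF i]
  have E_lin: "Vector_Spaces.linear smul smul (E a b)" if "a \<in> {i, i + 1}" "b \<in> {i, i + 1}" for a b
    unfolding E_def using that by (intro linear_compose_sub R_lin closed)
  have E_mult: "E a b (E a' b' w) = (if b = a' then E a b' w else 0)"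
    if "a \<in> {i, i + 1}" "b \<in> {i, i + 1}" "a' \<in> {i, i + 1}" "b' \<in> {i, i + 1}" for a b a' b' w
  proof -
    note D = closed(1) closed(2)[OF that(1,2)] closed(2)[OF that(3,4)]
    show ?thesis
      unfolding E_def
      by (simp add: linear_diff[OF R_lin[OF D(1)]] linear_diff[OF R_lin[OF D(2)]] R_mult[OF D(1)]
          R_mult[OF D(2)] D edge_outer_lines_comp[OF that])
  qed
  have sm: "a \<odot>\<^bsub>?A\<^esub> x \<in> carrier ?A" if "x \<in> carrier ?A" for a x
    using monoid_algebra_smult_closed that by (simp only: planar_rook_algebra_def)
  have S: "S w = w - (E i i w - smul c (E (i + 1) i w) - smul d (E i (i + 1) w) +
      smul (c * d) (E (i + 1) (i + 1) w))" for w
  proof -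
    have mem: "i \<in> {i, i + 1}" "i + 1 \<in> {i, i + 1}" by auto
    note D = cl[OF closed(1)] cl[OF closed(2)[OF mem(1,1)]] cl[OF closed(2)[OF mem(1,2)]]
      cl[OF closed(2)[OF mem(2,1)]] cl[OF closed(2)[OF mem(2,2)]] one_closed
    have "S w = smul (1 - c - d + c * d) (R ?O w) - R (?D i i) w + smul c (R (?D (i + 1) i) w) +
        smul d (R (?D i (i + 1)) w) - smul (c * d) (R (?D (i + 1) (i + 1)) w) + w"
      unfolding S_def phi5_generator_def Let_def local_diagram_eqs local_diagram_eqs(6)[OF i] one
        R_def
      by (simp only: eval D sm A.a_closed A.minus_closed \<rho>_one)
    then show ?thesis
      by (simp add: E_def vs1.scale_right_diff_distrib vs1.scale_left_distrib
          vs1.scale_left_diff_distrib algebra_simps)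
  qed
  show ?thesis
    unfolding S by (rule matrix_units_quadratic[OF vs _ E_lin E_mult]) auto
qed

section \<open>Representations through the Hecke algebra\<close>

theorem theorem3p2:
  fixes c d :: complex
    and n :: nat
    and \<phi>\<^sub>5 :: "braid \<Rightarrow> diagram \<Rightarrow> complex"
    and smul :: "complex \<Rightarrow> 'w \<Rightarrow> 'w::ab_group_add"
    and \<rho> :: "(diagram \<Rightarrow> complex) \<Rightarrow> 'w \<Rightarrow> 'w"
  assumes "c \<noteq> 0" and "d \<noteq> 0" and "n \<ge> 2"
    and "\<phi>\<^sub>5 \<in> hom (braid_group n) (units_of (planar_rook_algebra n))"
    and "\<And>i. i \<in> {1..n - 1} \<Longrightarrow> \<phi>\<^sub>5 (braid_sigma n i) = phi5_generator c d n i"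
    and "vector_space smul"
    and "\<rho> \<in> alg_hom (planar_rook_algebra n) (End_algebra smul)"
  shows "\<exists>\<psi> \<in> alg_hom (hecke_algebra n (c * d)) (End_algebra smul).
    \<forall>x \<in> carrier (braid_group_algebra n).
      linear_extension (End_algebra smul) (\<rho> \<circ> \<phi>\<^sub>5) x = \<psi> (hecke_map n (c * d) x)"
proof -
  let ?B = "braid_group n" and ?P = "planar_rook_algebra n" and ?E = "End_algebra smul"
  let ?A = "monoid_algebra ?B"
  let ?L = "linear_extension ?E (\<rho> \<circ> \<phi>\<^sub>5)"
  note vs = \<open>vector_space smul\<close> and \<rho> = \<open>\<rho> \<in> alg_hom ?P ?E\<close>
  have B: "monoid ?B" unfolding braid_group_def by (rule monoid_presented_group)
  interpret B: monoid ?B by fact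
  interpret A: ring ?A by (rule ring_monoid_algebra) fact
  interpret E: ring ?E by (rule ring_End_algebra) fact
  have \<rho>_hom: "\<rho> \<in> ring_hom ?P ?E" using \<rho> by (simp add: alg_hom_def)
  have \<phi>: "\<phi>\<^sub>5 b \<in> Units ?P" if "b \<in> carrier ?B" for b
    using assms(4) that by (auto simp: hom_def units_of_def)
  have \<phi>_mult: "\<phi>\<^sub>5 (a \<otimes>\<^bsub>?B\<^esub> b) = \<phi>\<^sub>5 a \<otimes>\<^bsub>?P\<^esub> \<phi>\<^sub>5 b" if "a \<in> carrier ?B" "b \<in> carrier ?B" for a b
    using assms(4) that by (simp add: hom_def units_of_def)
  have \<phi>_closed: "\<phi>\<^sub>5 b \<in> carrier ?P" if "b \<in> carrier ?B" for b
    using \<phi>[OF that] by (simp add: Units_def)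
  have hom: "\<rho> \<circ> \<phi>\<^sub>5 \<in> hom ?B ?E"
    using ring_hom_closed[OF \<rho>_hom \<phi>_closed] ring_hom_mult[OF \<rho>_hom \<phi>_closed \<phi>_closed]
    by (auto simp: hom_def \<phi>_mult simp del: End_algebra_simps)
  \<comment> \<open>An element of \<^const>\<open>hom\<close> need not preserve the unit, but the image of the unit is idempotent and
    invertible, hence the unit.\<close>
  have unit: "(\<rho> \<circ> \<phi>\<^sub>5) \<one>\<^bsub>?B\<^esub> = id"
  proof -
    let ?u = "\<phi>\<^sub>5 \<one>\<^bsub>?B\<^esub>"
    obtain y where y: "y \<in> carrier ?P" "y \<otimes>\<^bsub>?P\<^esub> ?u = \<one>\<^bsub>?P\<^esub>"
      using \<phi>[OF B.one_closed] by (auto simp: Units_def)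
    have inv: "\<rho> y \<circ> \<rho> ?u = id"
      using ring_hom_mult[OF \<rho>_hom y(1) \<phi>_closed[OF B.one_closed]] ring_hom_one[OF \<rho>_hom] y(2)
      by simp
    have "\<rho> ?u \<circ> \<rho> ?u = \<rho> ?u"
      using ring_hom_mult[OF \<rho>_hom \<phi>_closed[OF B.one_closed] \<phi>_closed[OF B.one_closed]]
        \<phi>_mult[OF B.one_closed B.one_closed] by simp
    then have "\<rho> y \<circ> \<rho> ?u \<circ> \<rho> ?u = \<rho> y \<circ> \<rho> ?u" by (simp only: comp_assoc)
    then show ?thesis by (simp add: inv)
  qed
  have L: "?L \<in> alg_hom ?A ?E"
    by (rule linear_extension_alg_hom[OF vs B hom unit])
  then have L_hom: "?L \<in> ring_hom ?A ?E" by (simp add: alg_hom_def)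
  note eval = alg_hom_End_eval[OF L vs]
  have L_one: "?L \<one>\<^bsub>?A\<^esub> w = w" for w
    using ring_hom_one[OF L_hom] by (simp del: monoid_algebra_simps)
  interpret L: ring_hom_ring ?A ?E ?L
    by (rule ring_hom_ringI2) (unfold_locales, rule L_hom)
  define gens where "gens = {(basis_elt (braid_sigma n i) \<ominus>\<^bsub>?A\<^esub> \<one>\<^bsub>?A\<^esub>) \<otimes>\<^bsub>?A\<^esub>
      (basis_elt (braid_sigma n i) \<oplus>\<^bsub>?A\<^esub> (c * d) \<odot>\<^bsub>?A\<^esub> \<one>\<^bsub>?A\<^esub>) | i. i \<in> {1..n - 1}}"
  have I: "hecke_ideal n (c * d) = Idl\<^bsub>?A\<^esub> gens"
    by (simp add: hecke_ideal_def braid_group_algebra_def gens_def Let_def del: monoid_algebra_simps)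
  have gens: "gens \<subseteq> carrier ?A \<and> gens \<subseteq> a_kernel ?A ?E ?L"
  proof -
    have "g \<in> carrier ?A \<and> ?L g = \<zero>\<^bsub>?E\<^esub>"
      if i: "i \<in> {1..n - 1}" and g: "g = (basis_elt (braid_sigma n i) \<ominus>\<^bsub>?A\<^esub> \<one>\<^bsub>?A\<^esub>) \<otimes>\<^bsub>?A\<^esub>
      (basis_elt (braid_sigma n i) \<oplus>\<^bsub>?A\<^esub> (c * d) \<odot>\<^bsub>?A\<^esub> \<one>\<^bsub>?A\<^esub>)" for g i
    proof
      let ?s = "basis_elt (braid_sigma n i)"
      have \<sigma>: "braid_sigma n i \<in> carrier ?B"
        using i by (auto simp: braid_sigma_def braid_group_def presented_group_def
            braid_generators_def group_words_def)
      have s: "?s \<in> carrier ?A" using \<sigma> by (rule basis_elt_closed)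
      note cl = s A.one_closed A.minus_closed A.a_closed A.m_closed monoid_algebra_smult_closed
      show "g \<in> carrier ?A" unfolding g by (intro cl)
      have Ls: "?L ?s = \<rho> (phi5_generator c d n i)"
        using linear_extension_basis_elt[OF vs _ \<sigma>, of "\<rho> \<circ> \<phi>\<^sub>5"] hom assms(5)[OF i]
        by (simp add: hom_def)
      have smul_one: "(c * d) \<odot>\<^bsub>?A\<^esub> \<one>\<^bsub>?A\<^esub> \<in> carrier ?A"
        by (rule monoid_algebra_smult_closed[OF A.one_closed])
      have minus: "?s \<ominus>\<^bsub>?A\<^esub> \<one>\<^bsub>?A\<^esub> \<in> carrier ?A"
        and plus: "?s \<oplus>\<^bsub>?A\<^esub> (c * d) \<odot>\<^bsub>?A\<^esub> \<one>\<^bsub>?A\<^esub> \<in> carrier ?A"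
        by (rule A.minus_closed[OF s A.one_closed], rule A.a_closed[OF s smul_one])
      have "?L g w = 0" for w
        unfolding g eval(3)[OF minus plus] eval(2)[OF s A.one_closed] eval(1)[OF s smul_one]
          eval(4)[OF A.one_closed] Ls L_one
        by (rule phi5_generator_quadratic[OF vs \<rho> i])
      then show "?L g = \<zero>\<^bsub>?E\<^esub>" by auto
    qed
    then show ?thesis unfolding gens_def a_kernel_def' by blast
  qed
  have ideal: "ideal (hecke_ideal n (c * d)) ?A"
    unfolding I using gens by (intro A.genideal_ideal) blast
  have "hecke_ideal n (c * d) \<subseteq> a_kernel ?A ?E ?L"
    unfolding I using gens by (intro A.genideal_minimal L.kernel_is_ideal) blast
  then have "?L x = \<zero>\<^bsub>?E\<^esub>" if "x \<in> hecke_ideal n (c * d)" for x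
    using that unfolding a_kernel_def' by blast
  from alg_hom_factor_quotient[OF A.ring_axioms E.ring_axioms ideal monoid_algebra_smult_closed L this]
  show ?thesis
    unfolding hecke_algebra_def hecke_map_def braid_group_algebra_def .
qed

end
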